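(* Let $p\in(0,1)$, $q=1-p$, $L>0$, $\alpha=q/4$ and $d_F=\frac{\log(4/q)}{\log2}$. In the jump-over strategy on the hyperfractal Manhattan network with total pop-up intensity $\lambda$, the expected distance to a free parking slot, $\mathbb{E}[D]=f\left(\tfrac p2\lambda L\right)$, satisfies $$\mathbb{E}[D]=\Theta\left(\lambda^{-1/d_F}\right)\qquad\text{as }\lambda\to\infty.$$
   Context: Hyperfractal Manhattan model: streets have a depth $k\in\{0,1,2,\dots\}$; on a street of depth $k$ free slots appear as a Poisson process of linear intensity $\lambda\frac p2\left(\frac q2\right)^k$, and the length of a segment travelled at depth $k$ is exponential with mean $2^{-k}L$, all independent. Jump-over strategy: as long as no slot is found, the car moves through streets of strictly decreasing depth (starting from infinite depth), where the depth may decrease by more than one unit at a turn. Let $k_1<k_2<\cdots$ be the depths enumerated from the smallest, with $k_1=0$; the probability of jumping from depth $k_{i+1}$ to depth $k_i$ is $p(k_i\mid k_{i+1})=2^{-(k_{i+1}-k_i)}$. Summing over all possible jumps, the expected driven distance is $\mathbb{E}[D]=f\left(\frac p2\lambda L\right)$, where $$f(x)=\sum_{k=0}^{\infty}L\,\frac{1}{1+x\alpha^{k}}\,\frac{1}{2^{k+1}}\,\gamma(x\alpha^{k+1}),\qquad \gamma(x)=\sum_{0=k_1<k_2<\cdots}\ \prod_{i\ge1}p(k_i\mid k_{i+1})\frac{1}{1+x\alpha^{k_{i+1}}}.$$ The sum over infinite increasing sequences is understood as an expectation: $\gamma(x)=\mathbb{E}\left[\prod_{i\ge1}\frac{1}{1+x\alpha^{G_1+\cdots+G_i}}\right]$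 with $G_1,G_2,\dots$ i.i.d., $\mathbb{P}(G_1=m)=2^{-m}$ for $m\ge1$; in particular $\gamma(0)=1$. $\Theta(\cdot)$ means bounded above and below by positive constant multiples for all large $\lambda$. *)

theory Defs
  imports "HOL-Probability.Probability" "HOL-Library.Landau_Symbols"
begin

definition jump_pmf :: "nat pmf" where
  "jump_pmf = map_pmf Suc (geometric_pmf (1/2))"

lemma pmf_jump_pmf: "pmf jump_pmf m = (if m = 0 then 0 else 1 / 2 ^ m)"
proof (cases m)
  case 0
  have "pmf jump_pmf 0 = 0"
    by (rule pmf_eq_0_set_pmf[THEN iffD2]) (simp add: jump_pmf_def)
  with 0 show ?thesis by simp
next
  case (Suc n)
  have "pmf jump_pmf (Suc n) = pmf (geometric_pmf (1/2)) n"
    unfolding jump_pmf_def by (rule pmf_map_inj') simp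
  with Suc show ?thesis by (simp add: power_one_over)
qed

text \<open>
  The jump sizes \<open>G\<^sub>1, G\<^sub>2, \<dots>\<close> are the coordinates \<open>G 0, G 1, \<dots>\<close> under the infinite product
  measure, and \<open>depth G i = G\<^sub>1 + \<dots> + G\<^sub>i\<close> is the depth \<open>k\<^bsub>i+1\<^esub>\<close> of the enumeration starting
  with \<open>k\<^sub>1 = 0\<close>. Hence the increments \<open>k\<^bsub>i+1\<^esub> - k\<^sub>i\<close> carry the weights
  \<open>p(k\<^sub>i | k\<^bsub>i+1\<^esub>) = 2 ^ -(k\<^bsub>i+1\<^esub> - k\<^sub>i)\<close>.
\<close>

definition jumps :: "(nat \<Rightarrow> nat) measure" where
  "jumps = PiM UNIV (\<lambda>_. measure_pmf jump_pmf)"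

definition depth :: "(nat \<Rightarrow> nat) \<Rightarrow> nat \<Rightarrow> nat" where
  "depth G i = (\<Sum>j<i. G j)"

definition jump_gamma :: "real \<Rightarrow> real \<Rightarrow> real" where
  "jump_gamma \<alpha> x = (\<integral>G. (\<Prod>i. 1 / (1 + x * \<alpha> ^ depth G (Suc i))) \<partial>jumps)"

text \<open>
  On a street of depth \<open>k\<close> the slot intensity is \<open>\<lambda> * (p/2) * (q/2) ^ k\<close> and the mean segment
  length is \<open>L / 2 ^ k\<close>; their product is \<open>x * \<alpha> ^ k\<close> with \<open>x = (p/2) * \<lambda> * L\<close> and
  \<open>\<alpha> = q/4\<close>, so \<open>1 / (1 + x * \<alpha> ^ k)\<close> is the probability that an exponentially distributed
  segment of depth \<open>k\<close> contains no slot. The expected driven distance \<open>E[D]\<close>, summed over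
  all possible jumps, is \<open>f ((p/2) * \<lambda> * L)\<close>.
\<close>

definition jump_f :: "real \<Rightarrow> real \<Rightarrow> real \<Rightarrow> real" where
  "jump_f L \<alpha> x =
     (\<Sum>k. L * (1 / (1 + x * \<alpha> ^ k)) * (1 / 2 ^ (k + 1)) * jump_gamma \<alpha> (x * \<alpha> ^ (k + 1)))"

lemma jump_gamma_0: "jump_gamma \<alpha> 0 = 1"
proof -
  interpret prob_space "PiM (UNIV :: nat set) (\<lambda>_. measure_pmf jump_pmf)"
    by (rule prob_space_PiM) (rule measure_pmf.prob_space_axioms)
  show ?thesis
    unfolding jump_gamma_def jumps_def by (simp add: prob_space[simplified])
qed

lemma depth_ge: "\<forall>j. G j \<ge> 1 \<Longrightarrow> i \<le> depth G i"
proof (induction i)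
  case (Suc i)
  then show ?case using add_mono[of i "depth G i" 1 "G i"] by (simp add: depth_def)
qed simp

lemma convergent_prod_jump:
  fixes \<alpha> x :: real
  assumes "0 < \<alpha>" "\<alpha> < 1" "0 \<le> x" "\<forall>j. G j \<ge> 1"
  shows "convergent_prod (\<lambda>i. 1 / (1 + x * \<alpha> ^ depth G (Suc i)))"
proof -
  have pos: "0 \<le> x * \<alpha> ^ n" for n using assms by simp
  have "summable (\<lambda>i. x * \<alpha> ^ i)"
    using assms by (intro summable_mult summable_geometric) auto
  then have "summable (\<lambda>i. x * \<alpha> ^ depth G (Suc i))"
  proof (rule summable_comparison_test')
    fix i :: nat
    have "i \<le> depth G (Suc i)"
      using depth_ge[OF assms(4), of "Suc i"] by simp
    then have "\<alpha> ^ depth G (Suc i) \<le> \<alpha> ^ i"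
      using assms by (intro power_decreasing) auto
    then show "norm (x * \<alpha> ^ depth G (Suc i)) \<le> x * \<alpha> ^ i"
      using pos[of "depth G (Suc i)"] assms by (simp add: mult_left_mono)
  qed
  then have "convergent_prod (\<lambda>i. 1 + x * \<alpha> ^ depth G (Suc i))"
  proof (intro summable_imp_convergent_prod_real)
    show "x * \<alpha> ^ depth G (Suc i) \<noteq> -1" for i
      using pos[of "depth G (Suc i)"] by linarith
  qed (use pos in auto)
  then have "convergent_prod (\<lambda>i. inverse (1 + x * \<alpha> ^ depth G (Suc i)))"
    by (rule convergent_prod_inverse)
  then show ?thesis by (simp add: inverse_eq_divide)
qed

end

theory Submission imports Defs begin

text \<open>
  The asymptotics come from the factor \<open>1 / (1 + x * \<alpha> ^ k) / 2 ^ (k + 1)\<close> alone; the factor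
  \<open>jump_gamma\<close> only contributes a bounded constant. It never exceeds 1, and for arguments in
  \<open>[0, 1]\<close> it is bounded away from 0, because jumps of size at least 1 make the exponents in the
  product grow at least linearly (\<open>jump_gamma_bounds\<close>).

  For large \<open>x\<close> let \<open>n\<close> be the critical depth, the one with \<open>\<alpha> < x * \<alpha> ^ n \<le> 1\<close>: streets
  shallower than \<open>n\<close> are likely to offer a slot, deeper ones rarely do. The summand at depth \<open>n\<close>
  has order \<open>2 ^ -n\<close>. The summands beyond \<open>n\<close> decay like \<open>2 ^ -k\<close>. Those before \<open>n\<close> are at most
  \<open>L * 2 ^ -n * (2 * \<alpha>) ^ (n - k - 1)\<close>, and \<open>2 * \<alpha> < 1\<close> makes them sum to order \<open>2 ^ -n\<close> as well.
  So \<open>jump_f L \<alpha> x\<close> has order \<open>2 ^ -n\<close>. With \<open>s = 1 / d\<^sub>F\<close>, the definition of the fractal dimension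
  says exactly that \<open>\<alpha> powr s = 1 / 2\<close>, so raising \<open>\<alpha> < x * \<alpha> ^ n \<le> 1\<close> to the power \<open>s\<close> turns
  \<open>2 ^ -n\<close> into \<open>x powr -s\<close>, up to a factor 2.
\<close>

section \<open>Measurability of infinite products\<close>

text \<open>
  Partial products of factors in \<open>(0, 1]\<close> always converge, but \<open>prodinf\<close> returns their limit only
  if it is nonzero. Otherwise it is a fixed unspecified number, the same for all such \<open>f\<close>. This
  explicit description makes measurability in a parameter accessible.
\<close>

lemma prodinf_le_one_eq:
  fixes f :: "nat \<Rightarrow> real"
  assumes f: "\<And>i. 0 < f i" "\<And>i. f i \<le> 1"
  shows "prodinf f = (if lim (\<lambda>n. \<Prod>i\<le>n. f i) = 0 then (THE p. False)
                      else lim (\<lambda>n. \<Prod>i\<le>n. f i))"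
    and "convergent (\<lambda>n. \<Prod>i\<le>n. f i)"
proof -
  have dec: "decseq (\<lambda>n. \<Prod>i\<le>n. f i)"
  proof (rule decseq_SucI)
    fix n
    have "0 \<le> (\<Prod>i\<le>n. f i)"
      using f(1) by (intro prod_nonneg) (auto intro: less_imp_le)
    then show "(\<Prod>i\<le>Suc n. f i) \<le> (\<Prod>i\<le>n. f i)"
      using f(2)[of "Suc n"] by (simp add: mult_left_le)
  qed
  have "0 \<le> (\<Prod>i\<le>n. f i)" for n
    using f(1) by (intro prod_nonneg) (auto intro: less_imp_le)
  with dec show conv: "convergent (\<lambda>n. \<Prod>i\<le>n. f i)"
    by (metis decseq_convergent convergentI)
  have nz: "f i \<noteq> 0" for i using f(1)[of i] by simp
  show "prodinf f = (if lim (\<lambda>n. \<Prod>i\<le>n. f i) = 0 then (THE p. False)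
                     else lim (\<lambda>n. \<Prod>i\<le>n. f i))"
  proof (cases "lim (\<lambda>n. \<Prod>i\<le>n. f i) = 0")
    case True
    have "\<not> f has_prod p" for p
    proof
      assume p: "f has_prod p"
      then have "convergent_prod f" by (rule has_prod_iff[THEN iffD1, THEN conjunct1])
      then show False using True convergent_prod_iff_convergent[of f, OF nz] by blast
    qed
    then show ?thesis using True by (simp add: prodinf_def)
  next
    case False
    then have "convergent_prod f"
      using conv convergent_prod_iff_convergent[of f, OF nz] by blast
    then show ?thesis using False prodinf_eq_lim[of f, OF _ nz] by simp
  qed
qed

lemma borel_measurable_prodinf_le_one:
  fixes f :: "nat \<Rightarrow> 'a \<Rightarrow> real"
  assumes [measurable]: "\<And>i. f i \<in> borel_measurable M"
    and f: "\<And>i x. 0 < f i x" "\<And>i x. f i x \<le> 1"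
  shows "(\<lambda>x. \<Prod>i. f i x) \<in> borel_measurable M"
proof -
  have [measurable]: "(\<lambda>x. lim (\<lambda>n. \<Prod>i\<le>n. f i x)) \<in> borel_measurable M"
    by (rule borel_measurable_lim_metric) measurable
  show ?thesis
    by (subst prodinf_le_one_eq(1)[OF f]) measurable
qed

section \<open>Bounds for the integral over the jump sizes\<close>

lemma prob_space_jumps: "prob_space jumps"
  unfolding jumps_def by (rule prob_space_PiM) (rule measure_pmf.prob_space_axioms)

lemma AE_jumps_ge_1: "AE G in jumps. \<forall>j. G j \<ge> 1"
proof -
  have "AE m in measure_pmf jump_pmf. m \<ge> 1"
    by (auto simp: AE_measure_pmf_iff jump_pmf_def)
  then have "AE G in jumps. G j \<ge> 1" for j
    unfolding jumps_def
    by (intro AE_PiM_component[where P = "\<lambda>m. 1 \<le> m"]) (auto intro: measure_pmf.prob_space_axioms)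
  then show ?thesis by (simp add: AE_all_countable)
qed

lemma depth_measurable [measurable]: "(\<lambda>G. depth G i) \<in> measurable jumps (count_space UNIV)"
proof -
  have [measurable]: "(\<lambda>G. G j) \<in> measurable jumps (count_space UNIV)" for j
  proof -
    have "(\<lambda>G. G j) \<in> measurable jumps (measure_pmf jump_pmf)"
      unfolding jumps_def by (rule measurable_component_singleton) simp
    then show ?thesis by (simp cong: measurable_cong_sets)
  qed
  show ?thesis unfolding depth_def by measurable
qed

text \<open>
  From \<open>1 + t \<le> exp t\<close>, the product of the factors \<open>1 / (1 + x * \<alpha> ^ m)\<close> over distinct \<open>m \<ge> 1\<close>
  is at least \<open>exp (- (\<Sum>m\<ge>1. x * \<alpha> ^ m))\<close>, and the geometric series gives the exponent.
\<close>

lemma jump_prod_bounds: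
  fixes \<alpha> x :: real
  assumes \<alpha>: "0 < \<alpha>" "\<alpha> < 1" and x: "0 \<le> x" and G: "\<forall>j. G j \<ge> 1"
  shows "exp (- (x * \<alpha> / (1 - \<alpha>))) \<le> (\<Prod>i. 1 / (1 + x * \<alpha> ^ depth G (Suc i)))"
    and "(\<Prod>i. 1 / (1 + x * \<alpha> ^ depth G (Suc i))) \<le> 1"
proof -
  let ?f = "\<lambda>i. 1 / (1 + x * \<alpha> ^ depth G (Suc i))"
  have "convergent_prod ?f" using assms by (intro convergent_prod_jump)
  then have lim: "(\<lambda>n. \<Prod>i\<le>n. ?f i) \<longlonglongrightarrow> prodinf ?f" by (rule convergent_prod_LIMSEQ)
  have nn: "0 \<le> x * \<alpha> ^ k" for k using \<alpha> x by simp
  have le: "(\<Prod>i\<le>n. ?f i) \<le> 1" for n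
    using nn by (intro prod_le_1) (smt (verit) divide_le_eq_1 zero_le_divide_1_iff)
  have ge: "exp (- (x * \<alpha> / (1 - \<alpha>))) \<le> (\<Prod>i\<le>n. ?f i)" for n
  proof -
    have "(\<Sum>i\<le>n. x * \<alpha> * \<alpha> ^ i) \<le> (\<Sum>i. x * \<alpha> * \<alpha> ^ i)"
      using \<alpha> x by (intro sum_le_suminf summable_mult summable_geometric) auto
    also have "\<dots> = x * \<alpha> / (1 - \<alpha>)"
      using \<alpha> by (subst suminf_mult) (auto simp: suminf_geometric intro: summable_geometric)
    finally have "exp (- (x * \<alpha> / (1 - \<alpha>))) \<le> exp (\<Sum>i\<le>n. - (x * \<alpha> * \<alpha> ^ i))"
      by (simp add: sum_negf)
    also have "\<dots> = (\<Prod>i\<le>n. exp (- (x * \<alpha> * \<alpha> ^ i)))" by (simp add: exp_sum)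
    also have "\<dots> \<le> (\<Prod>i\<le>n. ?f i)"
    proof (rule prod_mono, safe)
      fix i
      have "\<alpha> ^ depth G (Suc i) \<le> \<alpha> ^ Suc i"
        using depth_ge[OF G, of "Suc i"] \<alpha> by (intro power_decreasing) auto
      then have "x * \<alpha> ^ depth G (Suc i) \<le> x * \<alpha> * \<alpha> ^ i"
        using x by (simp add: mult_left_mono mult.assoc)
      then have "1 + x * \<alpha> ^ depth G (Suc i) \<le> exp (x * \<alpha> * \<alpha> ^ i)"
        using exp_ge_add_one_self[of "x * \<alpha> * \<alpha> ^ i"] by linarith
      then show "exp (- (x * \<alpha> * \<alpha> ^ i)) \<le> ?f i"
        using nn[of "depth G (Suc i)"] by (simp add: exp_minus field_simps)
    qed simp
    finally show ?thesis .
  qed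
  show "exp (- (x * \<alpha> / (1 - \<alpha>))) \<le> prodinf ?f"
    by (rule LIMSEQ_le_const[OF lim]) (use ge in blast)
  show "prodinf ?f \<le> 1"
    by (rule LIMSEQ_le_const2[OF lim]) (use le in blast)
qed

text \<open>
  The pointwise bounds concern sequences of positive jumps, so they hold almost surely. Measurability is
  nevertheless needed on the whole space, including sequences with zero jumps, for which the product
  may diverge to 0: without it the integral would be 0 by convention and the lower bound would fail.
\<close>

lemma jump_gamma_bounds:
  fixes \<alpha> x :: real
  assumes \<alpha>: "0 < \<alpha>" "\<alpha> < 1" and x: "0 \<le> x"
  shows "exp (- (x * \<alpha> / (1 - \<alpha>))) \<le> jump_gamma \<alpha> x" and "jump_gamma \<alpha> x \<le> 1"
proof -
  interpret prob_space jumps by (rule prob_space_jumps)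
  let ?P = "\<lambda>G. \<Prod>i. 1 / (1 + x * \<alpha> ^ depth G (Suc i))"
  have nn: "0 \<le> x * \<alpha> ^ k" for k using \<alpha> x by simp
  have meas: "?P \<in> borel_measurable jumps"
  proof (rule borel_measurable_prodinf_le_one)
    show "0 < 1 / (1 + x * \<alpha> ^ depth G (Suc i))" for i G
      using nn[of "depth G (Suc i)"] by simp
    show "1 / (1 + x * \<alpha> ^ depth G (Suc i)) \<le> 1" for i G
      using nn[of "depth G (Suc i)"] by simp
  qed measurable
  have lower: "AE G in jumps. exp (- (x * \<alpha> / (1 - \<alpha>))) \<le> ?P G"
    using AE_jumps_ge_1 by eventually_elim (rule jump_prod_bounds(1)[OF \<alpha> x])
  have upper: "AE G in jumps. ?P G \<le> 1"
    using AE_jumps_ge_1 by eventually_elim (rule jump_prod_bounds(2)[OF \<alpha> x])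
  have "AE G in jumps. norm (?P G) \<le> 1" unfolding real_norm_def
    using lower upper
  proof eventually_elim
    case (elim G)
    have "0 < exp (- (x * \<alpha> / (1 - \<alpha>)))" by simp
    then have "0 \<le> ?P G" using elim(1) by (meson less_imp_le order_trans)
    then show ?case using elim(2) by (simp only: abs_of_nonneg)
  qed
  then have int: "integrable jumps ?P" by (rule integrable_const_bound) (rule meas)
  show "exp (- (x * \<alpha> / (1 - \<alpha>))) \<le> jump_gamma \<alpha> x"
    unfolding jump_gamma_def by (rule integral_ge_const[OF int lower])
  show "jump_gamma \<alpha> x \<le> 1"
    unfolding jump_gamma_def by (rule integral_le_const[OF int upper])
qed

section \<open>Comparison with the summand at the critical depth\<close>

text \<open>
  The least \<open>n\<close> with \<open>x * \<alpha> ^ n \<le> 1\<close> works: if \<open>n > 0\<close>, minimality gives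
  \<open>1 < x * \<alpha> ^ (n - 1)\<close>, hence \<open>\<alpha> < x * \<alpha> ^ n\<close>. The assumption \<open>1 \<le> x\<close> covers \<open>n = 0\<close>.
\<close>

lemma critical_depth_exists:
  fixes \<alpha> x :: real
  assumes \<alpha>: "0 < \<alpha>" "\<alpha> < 1" and x: "1 \<le> x"
  obtains n where "\<alpha> < x * \<alpha> ^ n" and "x * \<alpha> ^ n \<le> 1"
proof -
  obtain m where "\<alpha> ^ m < 1 / x" using real_arch_pow_inv[of "1 / x" \<alpha>] \<alpha> x by auto
  then have "x * \<alpha> ^ m \<le> 1" using x by (simp add: field_simps)
  define n where "n = (LEAST n. x * \<alpha> ^ n \<le> 1)"
  have n: "x * \<alpha> ^ n \<le> 1" unfolding n_def by (rule LeastI) fact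
  have "\<alpha> < x * \<alpha> ^ n"
  proof (cases n)
    case 0
    then show ?thesis using \<alpha> x by simp
  next
    case (Suc k)
    then have "1 < x * \<alpha> ^ k"
      using not_less_Least[of k "\<lambda>n. x * \<alpha> ^ n \<le> 1"] by (simp add: n_def)
    then show ?thesis using mult_strict_left_mono[of 1 "x * \<alpha> ^ k" \<alpha>] \<alpha> Suc
      by (simp add: mult.left_commute)
  qed
  with n show ?thesis using that by blast
qed

text \<open>
  The lower bound keeps only the summand at depth \<open>n\<close>: there \<open>1 / (1 + x * \<alpha> ^ n) \<ge> 1 / 2\<close>, and the
  argument of \<open>jump_gamma\<close> lies in \<open>[0, 1]\<close>, where its value is at least \<open>exp (-1)\<close>. In the upper
  bound, \<open>1 / (1 - 2 * \<alpha>)\<close> accounts for the depths before \<open>n\<close> and the remaining 1 for the depths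
  from \<open>n\<close> on.
\<close>

lemma jump_f_critical_depth_bounds:
  fixes L \<alpha> x :: real
  assumes L: "0 < L" and \<alpha>: "0 < \<alpha>" "\<alpha> < 1 / 2" and x: "0 < x"
    and n: "\<alpha> < x * \<alpha> ^ n" "x * \<alpha> ^ n \<le> 1"
  shows "L * exp (- 1) / 4 * (1 / 2 ^ n) \<le> jump_f L \<alpha> x"
    and "jump_f L \<alpha> x \<le> L * (1 / (1 - 2 * \<alpha>) + 1) * (1 / 2 ^ n)"
proof -
  define a where "a = (\<lambda>k. L * (1 / (1 + x * \<alpha> ^ k)) * (1 / 2 ^ (k + 1))
                          * jump_gamma \<alpha> (x * \<alpha> ^ (k + 1)))"
  define b where "b k = L * (1 / (1 + x * \<alpha> ^ k)) * (1 / 2 ^ (k + 1))" for k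
  have f_eq: "jump_f L \<alpha> x = suminf a" unfolding jump_f_def a_def ..
  have pos: "0 < x * \<alpha> ^ k" for k using \<alpha> x by simp
  have \<gamma>: "exp (- (y * \<alpha> / (1 - \<alpha>))) \<le> jump_gamma \<alpha> y" "0 \<le> jump_gamma \<alpha> y"
    "jump_gamma \<alpha> y \<le> 1" if "0 \<le> y" for y
  proof -
    show *: "exp (- (y * \<alpha> / (1 - \<alpha>))) \<le> jump_gamma \<alpha> y" "jump_gamma \<alpha> y \<le> 1"
      using jump_gamma_bounds[of \<alpha> y] \<alpha> that by auto
    show "0 \<le> jump_gamma \<alpha> y" using *(1) exp_ge_zero order_trans by blast
  qed
  have b_nn: "0 \<le> b k" for k
    using L pos[of k] by (simp add: b_def)
  have a_eq: "a k = b k * jump_gamma \<alpha> (x * \<alpha> ^ (k + 1))" for k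
    by (simp add: a_def b_def)
  have a_nn: "0 \<le> a k" for k
    unfolding a_eq using b_nn[of k] \<gamma>(2)[of "x * \<alpha> ^ (k + 1)"] pos[of "k + 1"] by simp
  have a_le_b: "a k \<le> b k" for k
    unfolding a_eq using b_nn[of k] \<gamma>(3)[of "x * \<alpha> ^ (k + 1)"] pos[of "k + 1"]
    by (simp add: mult_left_le)
  have b_le: "b k \<le> L / 2 * (1 / 2) ^ k" for k
  proof -
    have "1 / (1 + x * \<alpha> ^ k) \<le> 1" using pos[of k] by simp
    then have "L * (1 / (1 + x * \<alpha> ^ k)) * (1 / 2 ^ (k + 1)) \<le> L * 1 * (1 / 2 ^ (k + 1))"
      using L by (intro mult_right_mono mult_left_mono) auto
    then show ?thesis by (simp add: b_def power_one_over)
  qed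
  have a_le: "a k \<le> L / 2 * (1 / 2) ^ k" for k using a_le_b b_le order_trans by blast
  have geo: "summable (\<lambda>k. L / 2 * (1 / 2 :: real) ^ k)"
    by (intro summable_mult summable_geometric) simp
  have sum_a: "summable a"
    by (rule summable_comparison_test'[OF geo]) (use a_nn a_le in auto)

  have "L * exp (- 1) / 4 * (1 / 2 ^ n) \<le> a n"
  proof -
    have y: "0 \<le> x * \<alpha> ^ (n + 1)" "x * \<alpha> ^ (n + 1) \<le> 1"
    proof -
      have "\<alpha> * (x * \<alpha> ^ n) \<le> 1 * 1" using n(2) \<alpha> pos[of n] by (intro mult_mono) auto
      then show "x * \<alpha> ^ (n + 1) \<le> 1" by (simp add: mult.left_commute)
    qed (use pos[of "n + 1"] in simp)
    have "x * \<alpha> ^ (n + 1) * (\<alpha> / (1 - \<alpha>)) \<le> 1 * 1"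
      using y \<alpha> by (intro mult_mono) (auto simp: field_simps)
    then have "exp (- 1) \<le> exp (- (x * \<alpha> ^ (n + 1) * \<alpha> / (1 - \<alpha>)))" by simp
    then have e: "exp (- 1) \<le> jump_gamma \<alpha> (x * \<alpha> ^ (n + 1))"
      using \<gamma>(1)[OF y(1)] by (rule order_trans)
    have "1 / 2 \<le> 1 / (1 + x * \<alpha> ^ n)" using n(2) pos[of n] by (simp add: field_simps)
    then have "L * (1 / 2) * (1 / 2 ^ (n + 1)) \<le> b n"
      unfolding b_def using L by (intro mult_right_mono mult_left_mono) auto
    then have "L * (1 / 2) * (1 / 2 ^ (n + 1)) * exp (- 1) \<le> a n"
      unfolding a_eq using e b_nn[of n] by (intro mult_mono) auto
    then show ?thesis by (simp add: mult_ac)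
  qed
  also have "a n \<le> suminf a"
    using sum_le_suminf[OF sum_a, of "{n}"] a_nn by simp
  finally show "L * exp (- 1) / 4 * (1 / 2 ^ n) \<le> jump_f L \<alpha> x" by (simp add: f_eq)

  have shallow: "(\<Sum>k<n. a k) \<le> L * (1 / 2 ^ n) * (1 / (1 - 2 * \<alpha>))"
  proof -
    have "a k \<le> L * (1 / 2 ^ n) * (2 * \<alpha>) ^ (n - Suc k)" if "k < n" for k
    proof -
      \<comment> \<open>With \<open>n = k + j + 1\<close>, the inequality \<open>\<alpha> < x * \<alpha> ^ n\<close> reads \<open>1 < x * \<alpha> ^ k * \<alpha> ^ j\<close>; so \<open>\<alpha> ^ j\<close> dominates \<open>1 / (x * \<alpha> ^ k)\<close>.\<close>
      define j where "j = n - Suc k"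
      have nj: "n = Suc (k + j)" using that by (simp add: j_def)
      have "\<alpha> * 1 \<le> \<alpha> * (x * \<alpha> ^ k * \<alpha> ^ j)"
        using n(1) by (simp add: nj power_add mult_ac)
      then have "1 \<le> x * \<alpha> ^ k * \<alpha> ^ j" using \<alpha>(1) by (simp only: mult_le_cancel_left_pos)
      moreover have "0 < \<alpha> ^ j" using \<alpha> by simp
      ultimately have "1 \<le> \<alpha> ^ j * (1 + x * \<alpha> ^ k)"
        by (simp add: algebra_simps)
      then have "1 / (1 + x * \<alpha> ^ k) \<le> \<alpha> ^ j" using pos[of k] by (simp add: divide_le_eq)
      then have "b k \<le> L * \<alpha> ^ j * (1 / 2 ^ (k + 1))"
        unfolding b_def using L by (intro mult_right_mono mult_left_mono) auto
      also have "\<dots> = L * (1 / 2 ^ n) * (2 * \<alpha>) ^ j"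
        by (simp add: nj power_add power_mult_distrib)
      finally show ?thesis using a_le_b[of k] by (simp add: j_def)
    qed
    then have "(\<Sum>k<n. a k) \<le> (\<Sum>k<n. L * (1 / 2 ^ n) * (2 * \<alpha>) ^ (n - Suc k))"
      by (intro sum_mono) auto
    also have "\<dots> = L * (1 / 2 ^ n) * (\<Sum>k<n. (2 * \<alpha>) ^ k)"
      by (simp only: sum_distrib_left [symmetric] sum.nat_diff_reindex[where g = "\<lambda>i. (2 * \<alpha>) ^ i"])
    also have "\<dots> \<le> L * (1 / 2 ^ n) * (1 / (1 - 2 * \<alpha>))"
    proof (rule mult_left_mono)
      have "(\<Sum>k<n. (2 * \<alpha>) ^ k) \<le> (\<Sum>k. (2 * \<alpha>) ^ k)"
        using \<alpha> by (intro sum_le_suminf summable_geometric) auto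
      also have "\<dots> = 1 / (1 - 2 * \<alpha>)"
        using \<alpha> by (intro suminf_geometric) auto
      finally show "(\<Sum>k<n. (2 * \<alpha>) ^ k) \<le> 1 / (1 - 2 * \<alpha>)" .
    qed (use L in simp)
    finally show ?thesis .
  qed
  have deep: "(\<Sum>k. a (k + n)) \<le> L * (1 / 2 ^ n)"
  proof -
    have "(\<Sum>k. a (k + n)) \<le> (\<Sum>k. L / 2 * (1 / 2) ^ (k + n))"
      using a_le summable_ignore_initial_segment[OF sum_a, of n]
        summable_ignore_initial_segment[OF geo, of n]
      by (intro suminf_le)
    also have "\<dots> = (\<Sum>k. L / 2 * (1 / 2 ^ n) * (1 / 2) ^ k)"
      by (simp add: power_add power_one_over mult_ac)
    also have "\<dots> = L / 2 * (1 / 2 ^ n) * (\<Sum>k. (1 / 2) ^ k)"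
      by (intro suminf_mult summable_geometric) simp
    also have "(\<Sum>k. (1 / 2 :: real) ^ k) = 2" by (subst suminf_geometric) auto
    finally show ?thesis by simp
  qed
  have "suminf a = (\<Sum>k. a (k + n)) + (\<Sum>k<n. a k)"
    by (rule suminf_split_initial_segment[OF sum_a])
  also have "\<dots> \<le> L * (1 / 2 ^ n) + L * (1 / 2 ^ n) * (1 / (1 - 2 * \<alpha>))"
    using deep shallow by (rule add_mono)
  also have "\<dots> = L * (1 / (1 - 2 * \<alpha>) + 1) * (1 / 2 ^ n)"
    by (simp add: distrib_left distrib_right mult_ac)
  finally show "jump_f L \<alpha> x \<le> L * (1 / (1 - 2 * \<alpha>) + 1) * (1 / 2 ^ n)" by (simp add: f_eq)
qed

text \<open>
  The exponent \<open>s\<close> is the one that makes \<open>x powr -s\<close> scale exactly like the weights: moving one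
  depth further multiplies \<open>x\<close> by \<open>\<alpha>\<close> and the weight by \<open>1 / 2\<close>.
\<close>

lemma jump_f_powr_bounds:
  fixes L \<alpha> x s :: real
  assumes L: "0 < L" and \<alpha>: "0 < \<alpha>" "\<alpha> < 1 / 2" and x: "1 \<le> x"
    and s: "0 < s" "\<alpha> powr s = 1 / 2"
  shows "L * exp (- 1) / 8 * x powr - s \<le> jump_f L \<alpha> x"
    and "jump_f L \<alpha> x \<le> L * (1 / (1 - 2 * \<alpha>) + 1) * x powr - s"
proof -
  obtain n where n: "\<alpha> < x * \<alpha> ^ n" "x * \<alpha> ^ n \<le> 1"
    using critical_depth_exists[of \<alpha> x] \<alpha> x by auto
  have scale: "(x * \<alpha> ^ n) powr s = x powr s * (1 / 2 ^ n)"
  proof -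
    have "(\<alpha> ^ n) powr s = (\<alpha> powr s) ^ n"
      using \<alpha> by (simp add: powr_realpow[symmetric] powr_powr mult.commute)
    then show ?thesis using \<alpha> x s by (simp add: powr_mult power_one_over)
  qed
  have "(x * \<alpha> ^ n) powr s \<le> 1 powr s"
    using n(2) s \<alpha> x by (intro powr_mono2) auto
  then have up: "1 / 2 ^ n \<le> x powr - s"
    using x unfolding scale by (simp add: powr_minus field_simps)
  have "\<alpha> powr s \<le> (x * \<alpha> ^ n) powr s"
    using n(1) s \<alpha> by (intro powr_mono2) auto
  then have low: "x powr - s / 2 \<le> 1 / 2 ^ n"
    using x unfolding scale s(2) by (simp add: powr_minus field_simps)
  have x0: "0 < x" using x by simp
  note bounds = jump_f_critical_depth_bounds[OF L \<alpha> x0 n]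
  have "L * exp (- 1) / 4 * (x powr - s / 2) \<le> L * exp (- 1) / 4 * (1 / 2 ^ n)"
    using low L by (intro mult_left_mono) auto
  then show "L * exp (- 1) / 8 * x powr - s \<le> jump_f L \<alpha> x"
    using bounds(1) by simp
  have "L * (1 / (1 - 2 * \<alpha>) + 1) * (1 / 2 ^ n) \<le> L * (1 / (1 - 2 * \<alpha>) + 1) * x powr - s"
    using up L \<alpha> by (intro mult_left_mono) auto
  then show "jump_f L \<alpha> x \<le> L * (1 / (1 - 2 * \<alpha>) + 1) * x powr - s"
    using bounds(2) by linarith
qed

theorem theorem5p1:
  fixes p q L \<alpha> d\<^sub>F :: real
  assumes "0 < p" and "p < 1" and "q = 1 - p" and "L > 0"
    and "\<alpha> = q / 4" and "d\<^sub>F = ln (4 / q) / ln 2"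
  shows "(\<lambda>lam. jump_f L \<alpha> (p / 2 * lam * L)) \<in> \<Theta>[at_top](\<lambda>lam. lam powr (- 1 / d\<^sub>F))"
proof -
  define s where "s = ln 2 / ln (4 / q)"
  define c where "c = p / 2 * L"
  have q: "0 < q" "q < 1" using assms by auto
  have \<alpha>: "0 < \<alpha>" "\<alpha> < 1 / 2" using q assms(5) by auto
  have ln_pos: "0 < ln (4 / q)" using q by (intro ln_gt_zero) (simp add: field_simps)
  have s: "0 < s" using ln_pos by (simp add: s_def)
  have "ln \<alpha> = - ln (4 / q)" unfolding assms(5) using q by (simp add: ln_div)
  then have "s * ln \<alpha> = - ln 2" using ln_pos by (simp add: s_def)
  then have "\<alpha> powr s = 1 / 2" using \<alpha> by (simp add: powr_def exp_minus)
  note bounds = jump_f_powr_bounds[OF assms(4) \<alpha> _ s this]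
  have c: "0 < c" using assms by (simp add: c_def)
  have exponent: "- 1 / d\<^sub>F = - s" by (simp add: s_def assms(6))
  let ?A = "L * exp (- 1) / 8 * c powr - s"
  let ?B = "L * (1 / (1 - 2 * \<alpha>) + 1) * c powr - s"
  show ?thesis
  proof (rule bigthetaI')
    show "0 < ?A" using assms(4) c by simp
    have "0 < 1 / (1 - 2 * \<alpha>) + 1" using \<alpha> by (intro add_pos_pos) auto
    then show "0 < ?B" using assms(4) c by simp
    show "\<forall>\<^sub>F lam in at_top. ?A * norm (lam powr (- 1 / d\<^sub>F)) \<le> norm (jump_f L \<alpha> (p / 2 * lam * L))
            \<and> norm (jump_f L \<alpha> (p / 2 * lam * L)) \<le> ?B * norm (lam powr (- 1 / d\<^sub>F))"
      using eventually_ge_at_top[of "1 / c"]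
    proof eventually_elim
      case (elim lam)
      have lam: "0 < lam" using elim c by (meson less_le_trans zero_less_divide_1_iff)
      have x: "p / 2 * lam * L = c * lam" by (simp add: c_def)
      have x1: "1 \<le> c * lam" using elim c by (simp add: divide_le_eq mult.commute)
      have split: "(c * lam) powr - s = c powr - s * lam powr - s"
        using c lam by (simp add: powr_mult)
      have low: "?A * lam powr - s \<le> jump_f L \<alpha> (c * lam)"
        using bounds(1)[OF x1] by (simp add: split mult_ac)
      have up: "jump_f L \<alpha> (c * lam) \<le> ?B * lam powr - s"
        using bounds(2)[OF x1] unfolding split by (simp only: mult.assoc)
      have "0 \<le> ?A * lam powr - s" using assms(4) by simp
      then have "0 \<le> jump_f L \<alpha> (c * lam)" using low by linarith
      then show ?case unfolding x exponent using low up by simp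
    qed
  qed
qed

end
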